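(* Let $(A,B,p,r,c_R)$ be a linear production situation with a common-pool resource with producer set $N$, let $P=\{S_1,\ldots,S_k\}$ be a partition of $N$, and let $(X_1,\ldots,X_k;\pi_1,\ldots,\pi_k)$ be the associated non cooperative game among the coalitions of $P$. If $d(P)>r$, then the set of all strict Nash equilibria (in pure strategies) of this game is $$\left\{z\in\prod_{i=1}^k[0,d_{S_i}] : \sum_{i=1}^k z_i=r\ \text{ and }\ z_i>0\ \text{ for all } i\in\{1,\ldots,k\}\right\}.$$
   Context: Linear production situation with a common-pool resource $(A,B,p,r,c_R)$: $N=\{1,\ldots,n\}$ is a finite set of producers, $Q=\{1,\ldots,q\}$ a finite set of resources, $G=\{1,\ldots,g\}$ a finite set of goods. Each producer $i\in N$ owns a resource vector $b^i\in\mathbb{R}_+^q$; $B$ is the $q\times n$ matrix of these vectors, and for each $t\in Q$ there is some $i\in N$ with $b^i_t>0$. For a (nonempty) coalition $S\subseteq N$, $b^S=\sum_{i\in S}b^i$. In addition there is a common-pool resource, with total available amount $r>0$ and fixed unit cost $c_R\ge 0$. $A$ is a $(q+1)\times g$ matrix with nonnegative entries $a_{tj}$ (amount of resource $t$ needed per unit of product $j$; row $q+1$ refers to the common-pool resource), with $a_{(q+1)j}>0$ for all $j\in G$, and for each $j\in G$ there is at least one $t\in Q$ with $a_{tj}>0$. The price vector $p\in\mathbb{R}^g$ has strictly positive entries and $p_j>a_{(q+1)j}c_R$ for all $j\in G$. For a coalition $S$ and $z\ge 0$, $value(S;z)$ is the maximum over $x\in\mathbb{R}^g$, $x\ge 0$,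 of $\sum_{j=1}^g p_jx_j-c_Rz$ subject to $Ax\le \begin{pmatrix} b^S\\ z\end{pmatrix}$. The optimal demand of $S$ is $d_S=\min\{z\in\mathbb{R}_+ : value(S;z)\text{ is maximum}\}$, i.e. the least maximizer of $z\mapsto value(S;z)$ over $\mathbb{R}_+$. Standing assumption: for every coalition $S$ there is $z\ge 0$ with $value(S;z)>0$ (hence $d_S>0$). For a partition $P=\{S_1,\ldots,S_k\}$ of $N$, $d(P)=\sum_{i=1}^k d_{S_i}$. The non cooperative game $(X_1,\ldots,X_k;\pi_1,\ldots,\pi_k)$ among the coalitions of $P$: player $i$ is coalition $S_i$, its strategy set is $X_i=[0,d_{S_i}]$, and its payoff is $\pi_i(z_1,\ldots,z_k)=0$ if $\sum_{l=1}^k z_l>r$ and $\pi_i(z_1,\ldots,z_k)=value(S_i;z_i)$ otherwise. A profile $z^*\in\prod_{i=1}^k X_i$ is a strict Nash equilibrium (in pure strategies) if for all $i$ and all $z_i\in X_i\setminus\{z_i^*\}$, $\pi_i(z^* )>\pi_i(z_1^*,\ldots,z_{i-1}^*,z_i,z_{i+1}^*,\ldots,z_k^* )$. *)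

theory Defs
  imports "HOL-Analysis.Analysis" "HOL-Library.Disjoint_Sets"
begin

text \<open>
  Producers, resources and goods are the elements of the finite types \<open>'n\<close>, \<open>'q\<close> and \<open>'g\<close>.
  The rows of the technology matrix are indexed by \<open>'q option\<close>: row \<open>Some t\<close> belongs to the
  privately owned resource \<open>t\<close>, and the extra row \<open>None\<close> to the common-pool resource.
  Column \<open>i\<close> of \<open>B\<close> is the resource vector of producer \<open>i\<close>.
\<close>

locale common_pool_situation =
  fixes A :: "real ^ 'g ^ ('q::finite option)"
    and B :: "real ^ 'n ^ 'q"
    and p :: "real ^ 'g"
    and r :: real
    and c\<^sub>R :: real
  assumes B_nonneg: "\<And>t i. B $ t $ i \<ge> 0"
    and B_pos: "\<And>t. \<exists>i. B $ t $ i > 0"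
    and r_pos: "r > 0"
    and cost_nonneg: "c\<^sub>R \<ge> 0"
    and A_nonneg: "\<And>t j. A $ t $ j \<ge> 0"
    and A_pool_pos: "\<And>j. A $ None $ j > 0"
    and A_resource_pos: "\<And>j. \<exists>t. A $ Some t $ j > 0"
    and p_pos: "\<And>j. p $ j > 0"
    and p_profitable: "\<And>j. p $ j > A $ None $ j * c\<^sub>R"

definition coalition_resources :: "real ^ 'n ^ 'q \<Rightarrow> 'n set \<Rightarrow> real ^ 'q" where
  "coalition_resources B S = (\<Sum>i\<in>S. column i B)"

definition feasible_plans ::
  "real ^ 'g ^ ('q::finite option) \<Rightarrow> real ^ 'n ^ 'q \<Rightarrow> 'n set \<Rightarrow> real \<Rightarrow> (real ^ 'g) set" where
  "feasible_plans A B S z =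
     {x. 0 \<le> x \<and>
         A *v x \<le> (\<chi> t. case t of Some s \<Rightarrow> coalition_resources B S $ s | None \<Rightarrow> z)}"

definition coalition_value ::
  "real ^ 'g ^ ('q::finite option) \<Rightarrow> real ^ 'n ^ 'q \<Rightarrow> real ^ 'g \<Rightarrow> real \<Rightarrow> 'n set \<Rightarrow> real \<Rightarrow> real"
where
  "coalition_value A B p c\<^sub>R S z =
     (GREATEST v. \<exists>x\<in>feasible_plans A B S z. v = (\<Sum>j\<in>UNIV. p $ j * x $ j) - c\<^sub>R * z)"

definition optimal_demand ::
  "real ^ 'g ^ ('q::finite option) \<Rightarrow> real ^ 'n ^ 'q \<Rightarrow> real ^ 'g \<Rightarrow> real \<Rightarrow> 'n set \<Rightarrow> real"
where
  "optimal_demand A B p c\<^sub>R S =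
     (LEAST z. is_arg_max (coalition_value A B p c\<^sub>R S) (\<lambda>z. 0 \<le> z) z)"

text \<open>
  The coalitions of the partition are listed as \<open>S 1, \<dots>, S k\<close>; player \<open>i\<close> of the game is \<open>S i\<close>.
\<close>

definition strategies ::
  "real ^ 'g ^ ('q::finite option) \<Rightarrow> real ^ 'n ^ 'q \<Rightarrow> real ^ 'g \<Rightarrow> real
     \<Rightarrow> (nat \<Rightarrow> 'n set) \<Rightarrow> nat \<Rightarrow> real set"
where
  "strategies A B p c\<^sub>R S i = {0..optimal_demand A B p c\<^sub>R (S i)}"

definition payoff ::
  "real ^ 'g ^ ('q::finite option) \<Rightarrow> real ^ 'n ^ 'q \<Rightarrow> real ^ 'g \<Rightarrow> real \<Rightarrow> real
     \<Rightarrow> nat \<Rightarrow> (nat \<Rightarrow> 'n set) \<Rightarrow> nat \<Rightarrow> (nat \<Rightarrow> real) \<Rightarrow> real"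
where
  "payoff A B p r c\<^sub>R k S i z =
     (if (\<Sum>l=1..k. z l) > r then 0 else coalition_value A B p c\<^sub>R (S i) (z i))"

definition strict_Nash_equilibrium ::
  "'i set \<Rightarrow> ('i \<Rightarrow> 's set) \<Rightarrow> ('i \<Rightarrow> ('i \<Rightarrow> 's) \<Rightarrow> real) \<Rightarrow> ('i \<Rightarrow> 's) \<Rightarrow> bool"
where
  "strict_Nash_equilibrium I X \<pi> z \<longleftrightarrow>
     z \<in> Pi\<^sub>E I X \<and> (\<forall>i\<in>I. \<forall>y\<in>X i - {z i}. \<pi> i z > \<pi> i (z(i := y)))"

end

theory Submission
  imports Defs
begin

text \<open>
  The function \<open>z \<mapsto> value(S; z)\<close> is concave on the nonnegative reals, because the production plans
  form a convex set, and it vanishes at \<open>0\<close>. It has a least maximiser: the resources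
  owned by \<open>S\<close> alone confine the plans to a compact set, so some plan maximises the profit net of
  the pool cost, and among these one has least pool consumption. By concavity the value is strictly
  increasing up to this least maximiser \<open>d\<^sub>S\<close>, which is positive by the standing assumption. Hence
  using the pool beyond \<open>r\<close> or not at all leaves a player indifferent to some deviation, leaving
  part of it unused leaves some player an improving one, and every remaining profile is strict.
\<close>

section \<open>Production plans with the pool constraint split off\<close>

definition private_plans ::
  "real ^ 'g ^ ('q::finite option) \<Rightarrow> real ^ 'n ^ 'q \<Rightarrow> 'n set \<Rightarrow> (real ^ 'g) set" where
  "private_plans A B S =
     {x. (\<forall>j. 0 \<le> x $ j) \<and> (\<forall>s. (A *v x) $ Some s \<le> coalition_resources B S $ s)}"

text \<open>Only the pool row mentions \<open>z\<close>; what remains is one fixed set, so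
  compactness and optimisation can be treated for all pool amounts at once.\<close>

lemma feasible_plans_eq:
  "feasible_plans A B S z = {x \<in> private_plans A B S. (A *v x) $ None \<le> z}"
proof -
  have "x \<in> feasible_plans A B S z \<longleftrightarrow> x \<in> private_plans A B S \<and> (A *v x) $ None \<le> z" for x
    unfolding feasible_plans_def private_plans_def less_eq_vec_def mem_Collect_eq
    by (subst split_option_all) auto
  then show ?thesis by blast
qed

lemma continuous_on_row_mult [continuous_intros]:
  fixes A :: "real ^ 'g ^ 'm"
  shows "continuous_on X (\<lambda>x. (A *v x) $ t)"
  unfolding matrix_vector_mult_def by (auto intro!: continuous_intros)

lemma convex_comb_row:
  fixes A :: "real ^ 'g ^ 'm"
  shows "(A *v (u *\<^sub>R x + v *\<^sub>R y)) $ t = u * (A *v x) $ t + v * (A *v y) $ t"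
  by (simp add: matrix_vector_right_distrib matrix_vector_mult_scaleR)

lemma convex_private_plans:
  fixes A :: "real ^ 'g ^ ('q::finite option)"
  shows "convex (private_plans A B S)"
  unfolding convex_def private_plans_def
  by (auto simp: convex_comb_row intro: convex_bound_le)

section \<open>Values and optimal demands of coalitions\<close>

context common_pool_situation
begin

abbreviation revenue :: "real ^ 'g \<Rightarrow> real" where
  "revenue x \<equiv> \<Sum>j\<in>UNIV. p $ j * x $ j"

abbreviation val :: "'n set \<Rightarrow> real \<Rightarrow> real" where
  "val \<equiv> coalition_value A B p c\<^sub>R"

abbreviation dem :: "'n set \<Rightarrow> real" where
  "dem \<equiv> optimal_demand A B p c\<^sub>R"

lemma entry_le_row:
  assumes "\<And>j. 0 \<le> x $ j"
  shows "A $ t $ j * x $ j \<le> (A *v x) $ t"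
  unfolding matrix_vector_mult_def
  by (auto intro!: member_le_sum mult_nonneg_nonneg A_nonneg assms)

lemma row_nonneg:
  assumes "x \<in> private_plans A B S"
  shows "0 \<le> (A *v x) $ t"
  using assms unfolding matrix_vector_mult_def private_plans_def
  by (auto intro!: sum_nonneg mult_nonneg_nonneg A_nonneg)

lemma zero_private_plan: "0 \<in> private_plans A B S"
  unfolding private_plans_def coalition_resources_def
  by (auto simp: column_def intro!: sum_nonneg B_nonneg)

text \<open>Every good consumes some privately owned resource, whose stock bounds the quantity of
  that good.\<close>

lemma compact_private_plans: "compact (private_plans A B S)"
proof -
  obtain t where t: "\<And>j. A $ Some (t j) $ j > 0"
    using A_resource_pos by metis
  have "private_plans A B S
      \<subseteq> cbox 0 (\<chi> j. coalition_resources B S $ t j / A $ Some (t j) $ j)"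
  proof
    fix x assume x: "x \<in> private_plans A B S"
    then have nn: "\<And>j. 0 \<le> x $ j" by (auto simp: private_plans_def)
    have "A $ Some (t j) $ j * x $ j \<le> coalition_resources B S $ t j" for j
      using entry_le_row[OF nn, of "Some (t j)" j] x unfolding private_plans_def
      by (force intro: order_trans)
    with t nn show "x \<in> cbox 0 (\<chi> j. coalition_resources B S $ t j / A $ Some (t j) $ j)"
      by (auto simp: mem_box_cart field_simps)
  qed
  then have "bounded (private_plans A B S)"
    using bounded_cbox bounded_subset by blast
  moreover have "closed (private_plans A B S)"
    unfolding private_plans_def
    by (intro closed_Collect_conj closed_Collect_all closed_Collect_le continuous_intros)
  ultimately show ?thesis by (simp add: compact_eq_bounded_closed)
qed

lemma compact_feasible_plans: "compact (feasible_plans A B S z)"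
proof -
  have "feasible_plans A B S z = private_plans A B S \<inter> {x. (A *v x) $ None \<le> z}"
    by (auto simp: feasible_plans_eq)
  moreover have "closed {x. (A *v x) $ None \<le> z}"
    by (intro closed_Collect_le continuous_intros)
  ultimately show ?thesis using compact_private_plans by auto
qed

text \<open>Turns \<open>GREATEST\<close> into an actual maximum: revenue is continuous on a compact
  set, which contains the zero plan since \<open>z\<close> is nonnegative.\<close>

lemma val_attained:
  assumes "0 \<le> z"
  obtains x where "x \<in> feasible_plans A B S z" "val S z = revenue x - c\<^sub>R * z"
    "\<And>y. y \<in> feasible_plans A B S z \<Longrightarrow> revenue y \<le> revenue x"
proof -
  have "0 \<in> feasible_plans A B S z"
    using assms zero_private_plan by (simp add: feasible_plans_eq)
  moreover have "continuous_on (feasible_plans A B S z) revenue"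
    by (intro continuous_intros)
  ultimately obtain x where x: "x \<in> feasible_plans A B S z"
    "\<And>y. y \<in> feasible_plans A B S z \<Longrightarrow> revenue y \<le> revenue x"
    using continuous_attains_sup[OF compact_feasible_plans] by blast
  moreover have "val S z = revenue x - c\<^sub>R * z"
    unfolding coalition_value_def using x by (intro Greatest_equality) auto
  ultimately show thesis using that by blast
qed

lemma val_ge:
  assumes "0 \<le> z" "x \<in> feasible_plans A B S z"
  shows "revenue x - c\<^sub>R * z \<le> val S z"
proof -
  obtain y where "val S z = revenue y - c\<^sub>R * z"
    "\<And>x. x \<in> feasible_plans A B S z \<Longrightarrow> revenue x \<le> revenue y"
    using val_attained[OF assms(1), of S] by blast
  then show ?thesis using assms(2) by simp
qed

text \<open>Every good consumes the pool, so without it only the zero plan is feasible.\<close>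

lemma val_0: "val S 0 = 0"
proof -
  obtain x where x: "x \<in> feasible_plans A B S 0" "val S 0 = revenue x - c\<^sub>R * 0"
    using val_attained[of 0 S] by auto
  then have nn: "\<And>j. 0 \<le> x $ j" and "(A *v x) $ None \<le> 0"
    by (auto simp: feasible_plans_eq private_plans_def)
  then have "A $ None $ j * x $ j \<le> 0" for j
    using entry_le_row[OF nn, of None j] by linarith
  then have "x $ j = 0" for j
    using nn[of j] A_pool_pos[of j] mult_pos_pos[of "A $ None $ j" "x $ j"]
    by (metis linorder_not_le order_le_less)
  with x show ?thesis by simp
qed

text \<open>Mixing optimal plans for \<open>a\<close> and \<open>b\<close> gives a plan feasible for
  the mixed pool amount, and profit is linear.\<close>

lemma concave_val: "concave_on {0..} (val S)"
  unfolding concave_on_iff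
proof (intro conjI ballI allI impI)
  show "convex {0::real..}" by (rule convex_real_interval)
  fix a b u v :: real
  assume ab: "a \<in> {0..}" "b \<in> {0..}" and uv: "0 \<le> u" "0 \<le> v" "u + v = 1"
  obtain x where x: "x \<in> feasible_plans A B S a" "val S a = revenue x - c\<^sub>R * a"
    using ab val_attained[of a S] by auto
  obtain y where y: "y \<in> feasible_plans A B S b" "val S b = revenue y - c\<^sub>R * b"
    using ab val_attained[of b S] by auto
  let ?w = "u *\<^sub>R x + v *\<^sub>R y"
  have "?w \<in> private_plans A B S"
    using x y uv convex_private_plans by (auto simp: feasible_plans_eq intro: convexD)
  moreover have "(A *v ?w) $ None \<le> u * a + v * b"
    using x y uv unfolding convex_comb_row
    by (intro add_mono mult_left_mono) (auto simp: feasible_plans_eq)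
  ultimately have "revenue ?w - c\<^sub>R * (u * a + v * b) \<le> val S (u * a + v * b)"
    using ab uv by (intro val_ge) (auto simp: feasible_plans_eq)
  moreover have "revenue ?w = u * revenue x + v * revenue y"
    by (simp add: sum_distrib_left sum.distrib algebra_simps)
  ultimately show "u * val S a + v * val S b \<le> val S (u *\<^sub>R a + v *\<^sub>R b)"
    by (simp add: x y algebra_simps)
qed

text \<open>Without this, \<open>LEAST\<close> in \<open>optimal_demand\<close> would not be known
  to denote a maximiser.\<close>

lemma ex_least_arg_max:
  "\<exists>d. is_arg_max (val S) (\<lambda>z. 0 \<le> z) d \<and> (\<forall>z. is_arg_max (val S) (\<lambda>z. 0 \<le> z) z \<longrightarrow> d \<le> z)"
proof -
  let ?K = "private_plans A B S"
  let ?use = "\<lambda>x. (A *v x) $ None"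
  \<comment> \<open>The pool is charged for what the plan consumes, not for \<open>z\<close>, so the
    search over pairs of plan and pool amount becomes a search over plans.\<close>
  let ?net = "\<lambda>x. revenue x - c\<^sub>R * ?use x"
  have "continuous_on ?K ?net" by (intro continuous_intros)
  moreover have "?K \<noteq> {}" using zero_private_plan by blast
  ultimately have "\<exists>x\<in>?K. \<forall>y\<in>?K. ?net y \<le> ?net x"
    using compact_private_plans by (intro continuous_attains_sup)
  then obtain x0 where x0: "x0 \<in> ?K" "\<And>y. y \<in> ?K \<Longrightarrow> ?net y \<le> ?net x0"
    by blast
  let ?E = "?K \<inter> {x. ?net x = ?net x0}"
  have "closed {x. ?net x = ?net x0}" by (intro closed_Collect_eq continuous_intros)
  then have "compact ?E" by (intro compact_Int_closed compact_private_plans)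
  moreover have "?E \<noteq> {}" using x0 by auto
  moreover have "continuous_on ?E ?use" by (intro continuous_intros)
  ultimately have "\<exists>x\<in>?E. \<forall>y\<in>?E. ?use x \<le> ?use y"
    by (rule continuous_attains_inf)
  then obtain x1 where x1: "x1 \<in> ?E" "\<And>y. y \<in> ?E \<Longrightarrow> ?use x1 \<le> ?use y"
    by blast
  have net_ge: "revenue x - c\<^sub>R * z \<le> ?net x" if "?use x \<le> z" for x z
    using mult_left_mono[OF that cost_nonneg] by simp
  have upper: "val S z \<le> ?net x0" if z: "0 \<le> z" for z
  proof -
    obtain x where x: "x \<in> feasible_plans A B S z" "val S z = revenue x - c\<^sub>R * z"
      using z by (rule val_attained)
    then have "x \<in> ?K" "?use x \<le> z" by (auto simp: feasible_plans_eq)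
    then show ?thesis using x(2) net_ge[of x z] x0(2)[of x] by linarith
  qed
  have nn: "0 \<le> ?use x1" using x1 row_nonneg by blast
  have "?net x0 \<le> val S (?use x1)"
    using val_ge[OF nn, of x1 S] x1 by (auto simp: feasible_plans_eq)
  then have eq: "val S (?use x1) = ?net x0" using upper[OF nn] by linarith
  have "?use x1 \<le> z" if z: "is_arg_max (val S) (\<lambda>z. 0 \<le> z) z" for z
  proof -
    have z0: "0 \<le> z" and vz: "val S z \<ge> ?net x0"
      using z eq nn unfolding is_arg_max_def by force+
    obtain x where x: "x \<in> feasible_plans A B S z" "val S z = revenue x - c\<^sub>R * z"
      using z0 by (rule val_attained)
    then have "x \<in> ?K" "?use x \<le> z" by (auto simp: feasible_plans_eq)
    \<comment> \<open>A plan optimal for a maximiser \<open>z\<close> also maximises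
      \<open>?net\<close>, so it lies in \<open>?E\<close> and consumes at least
      \<open>?use x1\<close>.\<close>
    moreover from this have "?net x = ?net x0"
      using x(2) vz net_ge[of x z] x0(2)[of x] by linarith
    ultimately show ?thesis using x1(2)[of x] by auto
  qed
  moreover have "is_arg_max (val S) (\<lambda>z. 0 \<le> z) (?use x1)"
    using nn eq upper unfolding is_arg_max_def by force
  ultimately show ?thesis by blast
qed

lemma dem_least_arg_max:
  shows "is_arg_max (val S) (\<lambda>z. 0 \<le> z) (dem S)"
    and "is_arg_max (val S) (\<lambda>z. 0 \<le> z) z \<Longrightarrow> dem S \<le> z"
proof -
  obtain d where d: "is_arg_max (val S) (\<lambda>z. 0 \<le> z) d"
    "\<And>z. is_arg_max (val S) (\<lambda>z. 0 \<le> z) z \<Longrightarrow> d \<le> z"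
    using ex_least_arg_max by blast
  then have "dem S = d"
    unfolding optimal_demand_def by (intro Least_equality) auto
  with d show "is_arg_max (val S) (\<lambda>z. 0 \<le> z) (dem S)"
    "is_arg_max (val S) (\<lambda>z. 0 \<le> z) z \<Longrightarrow> dem S \<le> z" by auto
qed

text \<open>The value at \<open>0\<close> is \<open>0\<close>, hence not maximal once some value is
  positive.\<close>

lemma dem_pos:
  assumes "\<exists>z\<ge>0. val S z > 0"
  shows "dem S > 0"
proof -
  have "dem S \<ge> 0" "dem S \<noteq> 0"
    using dem_least_arg_max(1)[of S] val_0[of S] assms unfolding is_arg_max_def by auto
  then show ?thesis by simp
qed

lemma strict_mono_on_val: "strict_mono_on {0..dem S} (val S)"
proof (rule strict_mono_onI)
  fix y z assume yz: "y \<in> {0..dem S}" "z \<in> {0..dem S}" "y < z"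
  have max: "val S x \<le> val S (dem S)" if "0 \<le> x" for x
    using dem_least_arg_max(1)[of S] that unfolding is_arg_max_def by force
  \<comment> \<open>Otherwise \<open>y\<close> would be a maximiser below the least one.\<close>
  have less: "val S y < val S (dem S)"
  proof (rule ccontr)
    assume "\<not> ?thesis"
    then have "is_arg_max (val S) (\<lambda>z. 0 \<le> z) y"
      using max yz unfolding is_arg_max_def by force
    then show False using dem_least_arg_max(2)[of S y] yz by auto
  qed
  \<comment> \<open>The weight placing \<open>z\<close> between \<open>y\<close> and
    \<open>dem S\<close>; since \<open>u > 0\<close>, concavity passes the strict gain at
    \<open>dem S\<close> on to \<open>z\<close>.\<close>
  define u where "u = (z - y) / (dem S - y)"
  have u: "0 < u" "u \<le> 1" using yz by (auto simp: u_def)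
  have "u * (dem S - y) = z - y" using yz by (simp add: u_def)
  then have "z = (1 - u) *\<^sub>R y + u *\<^sub>R dem S" by (simp add: algebra_simps)
  then have "(1 - u) * val S y + u * val S (dem S) \<le> val S z"
    using concave_val[of S] u yz unfolding concave_on_iff by auto
  moreover have "u * val S y < u * val S (dem S)" using u less by simp
  ultimately show "val S y < val S z" by (simp add: algebra_simps)
qed

end

section \<open>Strict equilibria under a shared capacity\<close>

lemma sum_update:
  fixes z :: "'i \<Rightarrow> real"
  assumes "finite I" "i \<in> I"
  shows "sum (z(i := y)) I = sum z I - z i + y"
proof -
  have "sum (z(i := y)) (I - {i}) = sum z (I - {i})" by (intro sum.cong) auto
  then show ?thesis
    using assms by (simp add: sum.remove[of I i])
qed

text \<open>The game stripped of production: the argument rests only on payoffs that vanish at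
  \<open>0\<close> and increase strictly up to a positive demand.\<close>

lemma strict_Nash_common_pool:
  fixes I :: "'i set" and d :: "'i \<Rightarrow> real" and v :: "'i \<Rightarrow> real \<Rightarrow> real" and r :: real
  defines "\<pi> \<equiv> \<lambda>i z. if sum z I > r then 0 else v i (z i)"
  assumes fin: "finite I"
    and mono: "\<And>i. i \<in> I \<Longrightarrow> strict_mono_on {0..d i} (v i)"
    and v0: "\<And>i. i \<in> I \<Longrightarrow> v i 0 = 0"
    and d_pos: "\<And>i. i \<in> I \<Longrightarrow> d i > 0"
    and r_pos: "r > 0" and demand: "sum d I > r"
  shows "strict_Nash_equilibrium I (\<lambda>i. {0..d i}) \<pi> z \<longleftrightarrow>
    z \<in> (\<Pi>\<^sub>E i\<in>I. {0..d i}) \<and> sum z I = r \<and> (\<forall>i\<in>I. z i > 0)"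
    (is "?N \<longleftrightarrow> ?R")
proof
  assume N: ?N
  then have z: "z \<in> (\<Pi>\<^sub>E i\<in>I. {0..d i})"
    and strict: "\<And>i y. i \<in> I \<Longrightarrow> y \<in> {0..d i} \<Longrightarrow> y \<noteq> z i \<Longrightarrow> \<pi> i (z(i := y)) < \<pi> i z"
    unfolding strict_Nash_equilibrium_def by auto
  have zi: "0 \<le> z i" "z i \<le> d i" if "i \<in> I" for i using z that by (auto simp: PiE_iff)
  have v_nonneg: "0 \<le> v i y" if "i \<in> I" "y \<in> {0..d i}" for i y
    using mono_onD[OF strict_mono_on_imp_mono_on[OF mono[OF that(1)]], of 0 y]
      v0[OF that(1)] that d_pos[OF that(1)] by auto
  have "\<not> sum z I > r"
  proof
    assume big: "sum z I > r"
    have "I \<noteq> {}" using demand r_pos by auto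
    then obtain i where i: "i \<in> I" by blast
    \<comment> \<open>Any strategy other than \<open>z i\<close> will do: it pays at least
      \<open>0\<close>, which is all that \<open>z\<close> pays once the capacity is
      exceeded.\<close>
    define y where "y = (if z i = 0 then d i else 0)"
    have y: "y \<in> {0..d i}" "y \<noteq> z i"
      using d_pos[OF i] by (auto simp: y_def)
    have "0 \<le> \<pi> i (z(i := y))" using v_nonneg[OF i y(1)] by (simp add: \<pi>_def)
    moreover have "\<pi> i z = 0" using big by (simp add: \<pi>_def)
    ultimately show False using strict[OF i y] by simp
  qed
  moreover have "\<not> sum z I < r"
  proof
    assume small: "sum z I < r"
    \<comment> \<open>If all players already used their full demand, the total would exceed
      \<open>r\<close>.\<close>
    then obtain i where i: "i \<in> I" "z i < d i"
      using demand sum_mono[of I d z] by force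
    define y where "y = min (d i) (z i + (r - sum z I))"
    have y: "y \<in> {0..d i}" "z i < y" using zi[OF i(1)] i small by (auto simp: y_def)
    have "sum (z(i := y)) I \<le> r" unfolding sum_update[OF fin i(1)] by (simp add: y_def)
    then have "\<pi> i (z(i := y)) = v i y" by (simp add: \<pi>_def)
    moreover have "\<pi> i z = v i (z i)" using small by (simp add: \<pi>_def)
    moreover have "v i (z i) < v i y"
      using strict_mono_onD[OF mono[OF i(1)]] zi[OF i(1)] y by auto
    ultimately show False using strict[OF i(1) y(1)] y(2) by simp
  qed
  ultimately have eq: "sum z I = r" by simp
  have "z i > 0" if i: "i \<in> I" for i
  proof (rule ccontr)
    assume "\<not> z i > 0"
    then have "z i = 0" using zi[OF i] by simp
    then have "\<pi> i z = 0" using eq v0[OF i] by (simp add: \<pi>_def)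
    \<comment> \<open>With the capacity exhausted, a player at \<open>0\<close> gets
      \<open>0\<close> by staying and \<open>0\<close> by overshooting, so strictness fails.\<close>
    moreover have "sum (z(i := d i)) I > r"
      unfolding sum_update[OF fin i] using eq \<open>z i = 0\<close> d_pos[OF i] by simp
    then have "\<pi> i (z(i := d i)) = 0" by (simp add: \<pi>_def)
    ultimately show False
      using strict[OF i, of "d i"] d_pos[OF i] \<open>z i = 0\<close> by auto
  qed
  with z eq show ?R by blast
next
  assume R: ?R
  have "\<pi> i (z(i := y)) < \<pi> i z" if i: "i \<in> I" and y: "y \<in> {0..d i}" "y \<noteq> z i" for i y
  proof -
    have zi: "0 < z i" "z i \<le> d i" using R i by (auto simp: PiE_iff)
    have eq: "\<pi> i z = v i (z i)" using R by (simp add: \<pi>_def)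
    have sum: "sum (z(i := y)) I = r - z i + y" unfolding sum_update[OF fin i] using R by simp
    show ?thesis
    proof (cases "y < z i")
      case True
      then have "v i y < v i (z i)"
        using strict_mono_onD[OF mono[OF i]] zi y by auto
      then show ?thesis using True sum eq by (simp add: \<pi>_def)
    next
      \<comment> \<open>Now \<open>y > z i\<close> overshoots \<open>r\<close> and pays
        \<open>0\<close>, whereas \<open>z i > 0\<close> earns a positive value.\<close>
      case False
      moreover have "0 < v i (z i)"
        using strict_mono_onD[OF mono[OF i], of 0 "z i"] v0[OF i] zi by auto
      ultimately show ?thesis using sum eq y by (simp add: \<pi>_def)
    qed
  qed
  with R show ?N unfolding strict_Nash_equilibrium_def by auto
qed

theorem theorem6:
  fixes A :: "real ^ 'g ^ ('q::finite option)"
    and B :: "real ^ 'n ^ 'q"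
    and p :: "real ^ 'g"
    and r c\<^sub>R :: real
    and k :: nat
    and S :: "nat \<Rightarrow> 'n set"
  assumes situation: "common_pool_situation A B p r c\<^sub>R"
    and standing: "\<And>T :: 'n set. T \<noteq> {} \<Longrightarrow> \<exists>z\<ge>0. coalition_value A B p c\<^sub>R T z > 0"
    and partition: "partition_on UNIV (S ` {1..k})" "inj_on S {1..k}"
    and demand: "(\<Sum>i=1..k. optimal_demand A B p c\<^sub>R (S i)) > r"
  shows "{z. strict_Nash_equilibrium {1..k} (strategies A B p c\<^sub>R S) (payoff A B p r c\<^sub>R k S) z} =
         {z \<in> (\<Pi>\<^sub>E i\<in>{1..k}. {0..optimal_demand A B p c\<^sub>R (S i)}).
            (\<Sum>i=1..k. z i) = r \<and> (\<forall>i\<in>{1..k}. z i > 0)}"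
proof -
  interpret common_pool_situation A B p r c\<^sub>R by (rule situation)
  \<comment> \<open>Blocks of a partition are nonempty, so the standing assumption applies to each
    player.\<close>
  have "S i \<noteq> {}" if "i \<in> {1..k}" for i
    using partition_onD3[OF partition(1)] that by force
  then have "dem (S i) > 0" if "i \<in> {1..k}" for i
    using that standing dem_pos by blast
  then have *: "strict_Nash_equilibrium {1..k} (\<lambda>i. {0..dem (S i)})
      (\<lambda>i z. if sum z {1..k} > r then 0 else val (S i) (z i)) z \<longleftrightarrow>
    z \<in> (\<Pi>\<^sub>E i\<in>{1..k}. {0..dem (S i)}) \<and> sum z {1..k} = r \<and> (\<forall>i\<in>{1..k}. z i > 0)" for z
    using demand by (intro strict_Nash_common_pool) (simp_all add: strict_mono_on_val val_0 r_pos)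
  have "strategies A B p c\<^sub>R S = (\<lambda>i. {0..dem (S i)})"
    by (simp add: strategies_def fun_eq_iff)
  moreover have "payoff A B p r c\<^sub>R k S = (\<lambda>i z. if sum z {1..k} > r then 0 else val (S i) (z i))"
    by (simp add: payoff_def fun_eq_iff)
  ultimately show ?thesis using * by auto
qed

end
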